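(* Let $n\ge 2$ and let $\mathcal{S}_n=\{|\psi_i\rangle\}_{i=1}^{d_1d_2\cdots d_n}$ be a complete orthonormal basis of $\bigotimes_{k=1}^n\mathbb{C}^{d_k}$. If none of the states $|\psi_i\rangle$ is fully product (i.e. none is of the form $\bigotimes_{k=1}^n|\xi_k\rangle$ with $|\xi_k\rangle\in\mathbb{C}^{d_k}$), then $\mathcal{S}_n$ does not admit even partial local random authentication (partial LRA).
   Context: An $n$-partite system ($n\ge 2$) has Hilbert space $\bigotimes_{k=1}^n\mathbb{C}^{d_k}$, each tensor factor being held by a different spatially separated party $B_k$. LOCC has its standard meaning: a protocol with finitely many rounds of local quantum measurements by individual parties and classical communication among all of them; a POVM is LOCC-implementable if its outcome statistics are produced by such a protocol (including classical post-processing). For a set $\mathcal{S}=\{|\psi_1\rangle,\dots,|\psi_N\rangle\}$, an unknown element of which is shared by the parties, the question $\mathcal{Q}_i$ is "is the shared state $|\psi_i\rangle$ or not?". The question $\mathcal{Q}_i$ can be perfectly answered under LOCC if there is a two-outcome LOCC-implementable POVM $\{M_i^{(0)},M_i^{(1)}\}$ with $\langle\psi_i|M_i^{(1)}|\psi_i\rangle=1$ and $\langle\psi_j|M_i^{(1)}|\psi_j\rangle=0$ for all $j\ne i$. The set $\mathcal{S}$ admits partial LRA if at least one question $\mathcal{Q}_j$, $1\le j\le N$, can be perfectly answered under LOCC. *)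

theory Defs
  imports "Jordan_Normal_Form.Schur_Decomposition"
begin

section \<open>Tensor products\<close>

text \<open>
  Party \<open>k < n\<close> holds \<open>\<complex>\<^bsup>d k\<^esup>\<close>, and the global space is \<open>\<complex>\<^bsup>D\<^esup>\<close> with
  \<open>D = (\<Prod>k<n. d k)\<close>. A global index \<open>i < D\<close> encodes a multi-index in mixed radix, party \<open>0\<close>
  being the least significant place; \<open>digit d k i\<close> is its \<open>k\<close>-th entry. The values of \<open>d\<close> at
  places \<open>k \<ge> n\<close> are irrelevant.
\<close>

definition digit :: "(nat \<Rightarrow> nat) \<Rightarrow> nat \<Rightarrow> nat \<Rightarrow> nat" where
  "digit d k i = (i div (\<Prod>j<k. d j)) mod d k"

definition tensor_vec :: "nat \<Rightarrow> (nat \<Rightarrow> complex vec) \<Rightarrow> complex vec" where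
  "tensor_vec n \<xi> =
     vec (\<Prod>k<n. dim_vec (\<xi> k)) (\<lambda>i. \<Prod>k<n. \<xi> k $ digit (\<lambda>k. dim_vec (\<xi> k)) k i)"

definition tensor_mat :: "nat \<Rightarrow> (nat \<Rightarrow> complex mat) \<Rightarrow> complex mat" where
  "tensor_mat n A =
     mat (\<Prod>k<n. dim_row (A k)) (\<Prod>k<n. dim_col (A k))
       (\<lambda>(i, j). \<Prod>k<n. A k $$ (digit (\<lambda>k. dim_row (A k)) k i, digit (\<lambda>k. dim_col (A k)) k j))"

definition fully_product :: "nat \<Rightarrow> (nat \<Rightarrow> nat) \<Rightarrow> complex vec \<Rightarrow> bool" where
  "fully_product n d v \<longleftrightarrow> (\<exists>\<xi>. (\<forall>k<n. \<xi> k \<in> carrier_vec (d k)) \<and> v = tensor_vec n \<xi>)"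

text \<open>Note that \<open>v \<bullet>c w\<close> conjugates its second argument, so it is \<open>\<langle>w|v\<rangle>\<close> in bra-ket notation.\<close>

definition complete_orthonormal_basis :: "nat \<Rightarrow> (nat \<Rightarrow> complex vec) \<Rightarrow> bool" where
  "complete_orthonormal_basis D \<psi> \<longleftrightarrow>
     vectorspace.basis class_ring (module_vec TYPE(complex) D) (\<psi> ` {..<D}) \<and>
     (\<forall>i<D. \<forall>j<D. \<psi> i \<bullet>c \<psi> j = (if i = j then 1 else 0))"

section \<open>Measurements\<close>

text \<open>
  A general measurement on \<open>\<complex>\<^bsup>m\<^esup>\<close> is given by its Kraus operators. They may be rectangular,
  which covers adjoining and discarding local ancillas.
\<close>

definition measurement :: "nat \<Rightarrow> complex mat list \<Rightarrow> bool" where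
  "measurement m As \<longleftrightarrow>
     (\<forall>A\<in>set As. dim_col A = m \<and> 0 < dim_row A) \<and>
     mat m m (\<lambda>(i, j). \<Sum>A\<leftarrow>As. (mat_adjoint A * A) $$ (i, j)) = 1\<^sub>m m"

definition positive_op :: "nat \<Rightarrow> complex mat \<Rightarrow> bool" where
  "positive_op D M \<longleftrightarrow> M \<in> carrier_mat D D \<and> (\<forall>v\<in>carrier_vec D. 0 \<le> (M *\<^sub>v v) \<bullet>c v)"

definition povm :: "nat \<Rightarrow> ('o::finite \<Rightarrow> complex mat) \<Rightarrow> bool" where
  "povm D M \<longleftrightarrow>
     (\<forall>x. positive_op D (M x)) \<and>
     mat D D (\<lambda>(i, j). \<Sum>x\<in>UNIV. M x $$ (i, j)) = 1\<^sub>m D"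

section \<open>LOCC\<close>

text \<open>
  A finite-round protocol is a finite tree. \<open>Measure k bs\<close>: party \<open>k\<close> performs the measurement
  with Kraus operators \<open>map fst bs\<close> and broadcasts its outcome, and all parties continue with
  the subprotocol attached to that outcome; later choices thus depend on the whole classical
  history. \<open>Announce x\<close>: stop and report \<open>x\<close>, where sending different leaves to the same \<open>x\<close> is
  the classical post-processing. Randomness (for instance in the post-processing) is obtained
  by measuring with Kraus operators \<open>sqrt p\<close> times the identity.
\<close>

datatype 'o protocol = Announce 'o | Measure nat "(complex mat \<times> 'o protocol) list"

text \<open>Here \<open>d\<close> gives the current local dimensions, which a measurement may change.\<close>

fun locc_protocol :: "nat \<Rightarrow> (nat \<Rightarrow> nat) \<Rightarrow> 'o protocol \<Rightarrow> bool" where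
  "locc_protocol n d (Announce x) \<longleftrightarrow> True"
| "locc_protocol n d (Measure k bs) \<longleftrightarrow>
     k < n \<and> measurement (d k) (map fst bs) \<and>
     (\<forall>(A, P)\<in>set bs. locc_protocol n (d(k := dim_row A)) P)"

definition local_op :: "nat \<Rightarrow> (nat \<Rightarrow> nat) \<Rightarrow> nat \<Rightarrow> complex mat \<Rightarrow> complex mat" where
  "local_op n d k A = tensor_mat n (\<lambda>j. if j = k then A else 1\<^sub>m (d j))"

text \<open>
  Post-measurement states are kept unnormalised: the squared norm of the state reached at a leaf
  is the probability of reaching that leaf. So for a unit vector \<open>v\<close>, \<open>outcome_prob n d P v y\<close>
  is the probability that \<open>P\<close> announces \<open>y\<close>.
\<close>

fun outcome_prob :: "nat \<Rightarrow> (nat \<Rightarrow> nat) \<Rightarrow> 'o protocol \<Rightarrow> complex vec \<Rightarrow> 'o \<Rightarrow> real" where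
  "outcome_prob n d (Announce x) v y = (if x = y then Re (v \<bullet>c v) else 0)"
| "outcome_prob n d (Measure k bs) v y =
     (\<Sum>(A, P)\<leftarrow>bs. outcome_prob n (d(k := dim_row A)) P (local_op n d k A *\<^sub>v v) y)"

text \<open>Pure input states suffice, since they determine the statistics on all mixed states.\<close>

definition locc_implementable :: "nat \<Rightarrow> (nat \<Rightarrow> nat) \<Rightarrow> ('o::finite \<Rightarrow> complex mat) \<Rightarrow> bool" where
  "locc_implementable n d M \<longleftrightarrow>
     povm (\<Prod>k<n. d k) M \<and>
     (\<exists>P. locc_protocol n d P \<and>
        (\<forall>v\<in>carrier_vec (\<Prod>k<n. d k). v \<bullet>c v = 1 \<longrightarrow>
           (\<forall>x. (M x *\<^sub>v v) \<bullet>c v = of_real (outcome_prob n d P v x))))"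

section \<open>Local random authentication\<close>

text \<open>
  \<open>answerable_locc n d N \<psi> i\<close>: for states \<open>\<psi> 0, \<dots>, \<psi> (N - 1)\<close>, the question whether the
  shared state is \<open>\<psi> i\<close> can be perfectly answered under LOCC. The outcomes (0) and (1) of the
  POVM are \<open>False\<close> and \<open>True\<close>.
\<close>

definition answerable_locc ::
  "nat \<Rightarrow> (nat \<Rightarrow> nat) \<Rightarrow> nat \<Rightarrow> (nat \<Rightarrow> complex vec) \<Rightarrow> nat \<Rightarrow> bool" where
  "answerable_locc n d N \<psi> i \<longleftrightarrow>
     (\<exists>M :: bool \<Rightarrow> complex mat. locc_implementable n d M \<and>
        (M True *\<^sub>v \<psi> i) \<bullet>c \<psi> i = 1 \<and>
        (\<forall>j<N. j \<noteq> i \<longrightarrow> (M True *\<^sub>v \<psi> j) \<bullet>c \<psi> j = 0))"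

definition partial_LRA ::
  "nat \<Rightarrow> (nat \<Rightarrow> nat) \<Rightarrow> nat \<Rightarrow> (nat \<Rightarrow> complex vec) \<Rightarrow> bool" where
  "partial_LRA n d N \<psi> \<longleftrightarrow> (\<exists>j<N. answerable_locc n d N \<psi> j)"

end

theory Submission
  imports Defs
begin

text \<open>
  If a protocol can announce \<open>y\<close> on input \<open>v\<close>, some leaf labelled \<open>y\<close> is reached, and a nonzero
  row of the product operator accumulated on the way to it is a product functional that does not
  vanish at \<open>v\<close> but vanishes on every input for which \<open>y\<close> is never announced. When \<open>\<psi> i\<close> is
  authenticated, this functional kills all other members of the orthonormal basis, so it is a
  multiple of \<open>\<langle>\<psi> i|\<close>, and \<open>\<psi> i\<close> is a product vector.
\<close>

section \<open>Mixed-radix digits of global indices\<close>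

lemma digit_cong:
  assumes "\<And>j. j \<le> k \<Longrightarrow> d j = d' j"
  shows "digit d k i = digit d' k i"
proof -
  have "(\<Prod>j<k. d j) = (\<Prod>j<k. d' j)" by (intro prod.cong refl assms) simp
  then show ?thesis by (simp add: digit_def assms)
qed

lemma digit_less: "d k > 0 \<Longrightarrow> digit d k i < d k"
  by (simp add: digit_def)

text \<open>The modulus is a multiple of the product of the radices up to place \<open>k\<close>, so
  the reduction changes only what lies above that place.\<close>

lemma digit_mod_prod:
  assumes "k < n"
  shows "digit d k (i mod (\<Prod>j<n. d j)) = digit d k i"
proof -
  have "(\<Prod>j<Suc k. d j) dvd (\<Prod>j<n. d j)"
    using assms by (intro prod_dvd_prod_subset) auto
  then obtain c where c: "(\<Prod>j<n. d j) = (\<Prod>j<k. d j) * (d k * c)"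
    by (auto simp: dvd_def mult.assoc)
  have "i mod (a * (b * c)) div a mod b = i div a mod b" for a b c :: nat
    by (cases "a = 0") (simp_all add: mod_mult2_eq[of i a "b * c"] mod_mod_cancel)
  then show ?thesis unfolding digit_def c .
qed

text \<open>Induction on the number of places: the lower digits fix the remainder modulo the product
  of the lower radices. The quotient is below \<open>d n\<close>, hence equals the top
  digit.\<close>

lemma digit_inj:
  assumes "i < (\<Prod>k<n. d k)" "j < (\<Prod>k<n. d k)"
    and "\<And>k. k < n \<Longrightarrow> digit d k i = digit d k j"
  shows "i = j"
  using assms
proof (induction n arbitrary: i j)
  case 0
  then show ?case by simp
next
  case (Suc n)
  let ?P = "\<Prod>k<n. d k"
  have "?P \<noteq> 0"
  proof
    assume "?P = 0"
    then have "(\<Prod>k<Suc n. d k) = 0" by (simp only: prod.lessThan_Suc mult_0)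
    with Suc.prems(1) show False by (simp only: not_less_zero)
  qed
  have "i mod ?P = j mod ?P"
  proof (rule Suc.IH)
    show "digit d k (i mod ?P) = digit d k (j mod ?P)" if "k < n" for k
      using Suc.prems(3)[of k] that by (simp only: digit_mod_prod[OF that] less_SucI)
  qed (use \<open>?P \<noteq> 0\<close> in \<open>simp_all only: mod_less_divisor neq0_conv\<close>)
  moreover have "i div ?P < d n" "j div ?P < d n"
    using Suc.prems(1,2)
    by (simp_all only: less_mult_imp_div_less prod.lessThan_Suc mult.commute[of _ "d n"])
  then have "i div ?P = j div ?P"
    using Suc.prems(3)[of n] by (simp add: digit_def)
  ultimately show ?case by (metis div_mult_mod_eq)
qed

text \<open>Distributivity: global indices run through all multi-indices. The index range splits
  into \<open>d n\<close> blocks, on each of which the top digit is constant and the lower digits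
  run through all their values.\<close>

lemma sum_prod_digit:
  fixes f :: "nat \<Rightarrow> nat \<Rightarrow> 'a::comm_semiring_1"
  shows "(\<Sum>i<(\<Prod>k<n. d k). \<Prod>k<n. f k (digit d k i)) = (\<Prod>k<n. \<Sum>a<d k. f k a)"
proof (induction n)
  case 0
  then show ?case by simp
next
  case (Suc n)
  let ?P = "\<Prod>k<n. d k"
  have "(\<Sum>i<(\<Prod>k<Suc n. d k). \<Prod>k<Suc n. f k (digit d k i))
      = (\<Sum>q<d n. \<Sum>i\<in>{q * ?P..<q * ?P + ?P}. \<Prod>k<Suc n. f k (digit d k i))"
    by (simp add: sum.nat_group mult.commute)
  also have "\<dots> = (\<Sum>q<d n. \<Sum>r<?P. (\<Prod>k<n. f k (digit d k r)) * f n q)"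
  proof (rule sum.cong[OF refl])
    fix q assume q: "q \<in> {..<d n}"
    have "(\<Sum>i\<in>{q * ?P..<q * ?P + ?P}. \<Prod>k<Suc n. f k (digit d k i))
        = (\<Sum>r<?P. \<Prod>k<Suc n. f k (digit d k (q * ?P + r)))"
      using sum.shift_bounds_nat_ivl[of "\<lambda>i. \<Prod>k<Suc n. f k (digit d k i)" 0 "q * ?P" ?P]
      by (simp add: lessThan_atLeast0 add.commute)
    also have "\<dots> = (\<Sum>r<?P. (\<Prod>k<n. f k (digit d k r)) * f n q)"
    proof (rule sum.cong[OF refl])
      fix r assume r: "r \<in> {..<?P}"
      have div_eq: "(q * p + r) div p = q" if "r < p" for p using that by simp
      have "(q * ?P + r) div ?P = q" by (rule div_eq) (use r in simp)
      then have "digit d n (q * ?P + r) = q" using q by (simp add: digit_def)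
      moreover have "digit d k (q * ?P + r) = digit d k r" if "k < n" for k
        using digit_mod_prod[OF that, of d "q * ?P + r"] r by simp
      ultimately show "(\<Prod>k<Suc n. f k (digit d k (q * ?P + r)))
          = (\<Prod>k<n. f k (digit d k r)) * f n q" by simp
    qed
    finally show "(\<Sum>i\<in>{q * ?P..<q * ?P + ?P}. \<Prod>k<Suc n. f k (digit d k i))
        = (\<Sum>r<?P. (\<Prod>k<n. f k (digit d k r)) * f n q)" .
  qed
  also have "\<dots> = (\<Prod>k<Suc n. \<Sum>a<d k. f k a)"
    by (simp add: Suc.IH flip: sum_distrib_right sum_distrib_left)
  finally show ?case .
qed

section \<open>Product vectors in coordinates\<close>

lemma fully_product_altdef:
  assumes d: "\<forall>k<n. d k > 0"
  shows "fully_product n d v \<longleftrightarrow>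
    (\<exists>f. v = vec (\<Prod>k<n. d k) (\<lambda>i. \<Prod>k<n. f k (digit d k i)))"
proof
  assume "fully_product n d v"
  then obtain \<xi> where \<xi>: "\<forall>k<n. \<xi> k \<in> carrier_vec (d k)" and v: "v = tensor_vec n \<xi>"
    unfolding fully_product_def by blast
  \<comment> \<open>\<open>tensor_vec\<close> reads its radices off the factors. These agree with
    \<open>d\<close> below \<open>n\<close>, and digit \<open>k\<close> depends only on the radices
    up to \<open>k\<close>.\<close>
  have *: "digit (\<lambda>k. dim_vec (\<xi> k)) k i = digit d k i" if "k < n" for k i
    using that \<xi> by (intro digit_cong) auto
  have "(\<Prod>k<n. dim_vec (\<xi> k)) = (\<Prod>k<n. d k)" using \<xi> by (intro prod.cong) auto
  then have "v = vec (\<Prod>k<n. d k) (\<lambda>i. \<Prod>k<n. \<xi> k $ digit d k i)"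
    unfolding v tensor_vec_def by (intro eq_vecI) (auto simp: *)
  then show "\<exists>f. v = vec (\<Prod>k<n. d k) (\<lambda>i. \<Prod>k<n. f k (digit d k i))"
    by (rule exI[of _ "\<lambda>k a. \<xi> k $ a"])
next
  assume "\<exists>f. v = vec (\<Prod>k<n. d k) (\<lambda>i. \<Prod>k<n. f k (digit d k i))"
  then obtain f where v: "v = vec (\<Prod>k<n. d k) (\<lambda>i. \<Prod>k<n. f k (digit d k i))" by blast
  \<comment> \<open>Positive dimensions keep every digit below \<open>d k\<close>, so each factor is
    read only at valid indices.\<close>
  have "v = tensor_vec n (\<lambda>k. vec (d k) (f k))"
    unfolding v tensor_vec_def by (intro eq_vecI) (auto simp: d digit_less intro!: prod.cong)
  then show "fully_product n d v"
    unfolding fully_product_def by (intro exI[of _ "\<lambda>k. vec (d k) (f k)"]) auto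
qed

text \<open>Party \<open>0\<close> absorbs the scalar, which requires at least one party.\<close>

lemma fully_product_smult:
  assumes d: "\<forall>k<n. d k > 0" and "n > 0" and "fully_product n d v"
  shows "fully_product n d (c \<cdot>\<^sub>v v)"
proof -
  obtain f where v: "v = vec (\<Prod>k<n. d k) (\<lambda>i. \<Prod>k<n. f k (digit d k i))"
    using assms(3) fully_product_altdef[OF d] by blast
  have "c * (\<Prod>k<n. f k (digit d k i)) = (\<Prod>k<n. (if k = 0 then c else 1) * f k (digit d k i))" for i
    using \<open>n > 0\<close> by (simp add: prod.distrib)
  then have "c \<cdot>\<^sub>v v = vec (\<Prod>k<n. d k)
      (\<lambda>i. \<Prod>k<n. (if k = 0 then c else 1) * f k (digit d k i))"
    unfolding v by (intro eq_vecI) auto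
  then show ?thesis unfolding fully_product_altdef[OF d]
    by (rule exI[of _ "\<lambda>k a. (if k = 0 then c else 1) * f k a"])
qed

lemma fully_product_conjugate:
  assumes d: "\<forall>k<n. d k > 0" and "fully_product n d v"
  shows "fully_product n d (conjugate v)"
proof -
  obtain f where v: "v = vec (\<Prod>k<n. d k) (\<lambda>i. \<Prod>k<n. f k (digit d k i))"
    using assms(2) fully_product_altdef[OF d] by blast
  have "conjugate v = vec (\<Prod>k<n. d k) (\<lambda>i. \<Prod>k<n. cnj (f k (digit d k i)))"
    unfolding v by (intro eq_vecI) auto
  then show ?thesis unfolding fully_product_altdef[OF d] by (rule exI[of _ "\<lambda>k a. cnj (f k a)"])
qed

text \<open>Digits determine the index, so being equal to \<open>m\<close> is the conjunction over
  all parties of having the same digit as \<open>m\<close>, and its indicator factorises.\<close>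

lemma fully_product_unit_vec:
  assumes d: "\<forall>k<n. d k > 0" and m: "m < (\<Prod>k<n. d k)"
  shows "fully_product n d (unit_vec (\<Prod>k<n. d k) m)"
proof -
  have "(\<Prod>k<n. if digit d k i = digit d k m then 1 else 0) = (if i = m then 1 else 0 :: complex)"
    if "i < (\<Prod>k<n. d k)" for i
    using digit_inj[OF that m] by (auto intro: prod_zero)
  then have "unit_vec (\<Prod>k<n. d k) m = vec (\<Prod>k<n. d k)
      (\<lambda>i. \<Prod>k<n. if digit d k i = digit d k m then 1 else (0 :: complex))"
    by (intro eq_vecI) (simp_all add: m)
  then show ?thesis unfolding fully_product_altdef[OF d]
    by (rule exI[of _ "\<lambda>k a. if a = digit d k m then 1 else 0"])
qed

section \<open>Local operators and product functionals\<close>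

lemma local_op_altdef:
  assumes "dim_col A = d k"
  shows "local_op n d k A = mat (\<Prod>j<n. (d(k := dim_row A)) j) (\<Prod>j<n. d j)
    (\<lambda>(r, s). \<Prod>j<n. (if j = k then A else 1\<^sub>m (d j)) $$ (digit (d(k := dim_row A)) j r, digit d j s))"
proof -
  have "(\<lambda>j. dim_row (if j = k then A else 1\<^sub>m (d j))) = d(k := dim_row A)" by auto
  moreover have "(\<lambda>j. dim_col (if j = k then A else 1\<^sub>m (d j))) = d" using assms by auto
  ultimately show ?thesis unfolding local_op_def tensor_mat_def by metis
qed

text \<open>A product functional on the space after the measurement pulls back to a product
  functional on the space before it, since the transpose acts on each tensor factor separately. It
  is the transpose and not the adjoint because functionals act through the bilinear
  \<open>\<bullet>\<close>.\<close>

lemma fully_product_local_op_transpose: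
  assumes d: "\<forall>j<n. d j > 0" and A: "dim_col A = d k" "dim_row A > 0"
    and "fully_product n (d(k := dim_row A)) x"
  shows "fully_product n d (transpose_mat (local_op n d k A) *\<^sub>v x)"
proof -
  let ?e = "d(k := dim_row A)" and ?B = "\<lambda>j. if j = k then A else 1\<^sub>m (d j)"
  have e: "\<forall>j<n. ?e j > 0" using d A by simp
  obtain f where x: "x = vec (\<Prod>j<n. ?e j) (\<lambda>i. \<Prod>j<n. f j (digit ?e j i))"
    using assms(4) fully_product_altdef[OF e] by blast
  \<comment> \<open>The factor of party \<open>j\<close> after the pullback: the transpose of
    \<open>?B j\<close> applied to \<open>f j\<close>.\<close>
  define g where "g = (\<lambda>j b. \<Sum>a<?e j. ?B j $$ (a, b) * f j a)"
  have "transpose_mat (local_op n d k A) *\<^sub>v x = vec (\<Prod>j<n. d j) (\<lambda>s. \<Prod>j<n. g j (digit d j s))"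
    (is "?l = ?r")
  proof (rule eq_vecI)
    fix s assume "s < dim_vec ?r"
    then have "?l $ s = (\<Sum>r<(\<Prod>j<n. ?e j).
        \<Prod>j<n. ?B j $$ (digit ?e j r, digit d j s) * f j (digit ?e j r))"
      unfolding local_op_altdef[where d = d and k = k, OF A(1)] x
      by (simp add: scalar_prod_def prod.distrib lessThan_atLeast0)
    also have "\<dots> = (\<Prod>j<n. g j (digit d j s))"
      unfolding g_def
      using sum_prod_digit[of "\<lambda>j a. ?B j $$ (a, digit d j s) * f j a" ?e n] by simp
    finally show "?l $ s = ?r $ s" using \<open>s < dim_vec ?r\<close> by simp
  qed (simp add: local_op_altdef[where d = d and k = k, OF A(1)])
  then show ?thesis unfolding fully_product_altdef[OF d] by (rule exI[of _ g])
qed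

section \<open>Outcome probabilities and the functional attached to a leaf\<close>

lemma cscalar_prod_self_nonneg:
  fixes v :: "complex vec"
  shows "0 \<le> Re (v \<bullet>c v)"
  using conjugate_square_ge_0_vec[of v] by (auto simp: less_eq_complex_def)

text \<open>Positivity rules out cancellation between branches: a total of zero makes every branch
  contribute zero.\<close>

lemma outcome_prob_nonneg: "0 \<le> outcome_prob n d P v y"
proof (induction P arbitrary: d v)
  case (Announce x)
  then show ?case by (simp add: cscalar_prod_self_nonneg)
next
  case (Measure k bs)
  then show ?case by (force intro!: sum_list_nonneg)
qed

text \<open>Induction on the protocol with \<open>d\<close> and \<open>v\<close> arbitrary, as each
  measurement changes both. The vectors \<open>w\<close> are not normalised, since post-measurement
  states are not.\<close>

lemma ex_fully_product_functional:
  assumes "locc_protocol n d P" and "\<forall>k<n. d k > 0"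
    and "v \<in> carrier_vec (\<Prod>k<n. d k)" and "outcome_prob n d P v y \<noteq> 0"
  shows "\<exists>x\<in>carrier_vec (\<Prod>k<n. d k). fully_product n d x \<and> x \<bullet> v \<noteq> 0 \<and>
    (\<forall>w\<in>carrier_vec (\<Prod>k<n. d k). outcome_prob n d P w y = 0 \<longrightarrow> x \<bullet> w = 0)"
  using assms
proof (induction P arbitrary: d v)
  case (Announce z)
  let ?D = "\<Prod>k<n. d k"
  have z: "z = y" and "v \<bullet>c v \<noteq> 0" using Announce.prems(4) by (auto split: if_splits)
  then have "v \<noteq> 0\<^sub>v ?D" using Announce.prems(3) by auto
  \<comment> \<open>At a leaf a coordinate functional suffices: it can be chosen nonzero at
    \<open>v\<close>, and a vector of zero weight is zero.\<close>
  then obtain m where m: "m < ?D" "v $ m \<noteq> 0" using Announce.prems(3)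
    by (metis eq_vecI carrier_vecD index_zero_vec)
  have zero: "w = 0\<^sub>v ?D" if "w \<in> carrier_vec ?D" "Re (w \<bullet>c w) = 0" for w :: "complex vec"
  proof -
    have "0 \<le> w \<bullet>c w" by blast
    with that(2) have "w \<bullet>c w = 0" by (auto simp: complex_eq_iff less_eq_complex_def)
    with that(1) show ?thesis by simp
  qed
  from m z Announce.prems(3) show ?case
    by (intro bexI[of _ "unit_vec ?D m"] conjI ballI impI fully_product_unit_vec Announce.prems(2))
      (auto simp: scalar_prod_left_unit dest!: zero)
next
  case (Measure k bs)
  let ?e = "\<lambda>A. d(k := dim_row A)"
  have loc: "measurement (d k) (map fst bs)"
    "\<And>A P. (A, P) \<in> set bs \<Longrightarrow> locc_protocol n (?e A) P"
    using Measure.prems(1) by auto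
  have dims: "dim_col A = d k" "dim_row A > 0" if "(A, P) \<in> set bs" for A P
    using loc(1) that unfolding measurement_def by force+
  have op: "local_op n d k A \<in> carrier_mat (\<Prod>j<n. ?e A j) (\<Prod>j<n. d j)"
    if "(A, P) \<in> set bs" for A P
    unfolding local_op_altdef[where d = d and k = k, OF dims(1)[OF that]] by simp
  \<comment> \<open>A nonzero sum over the branches has a nonzero term. The functional of that
    branch is pulled back along its Kraus operator.\<close>
  obtain A P where AP: "(A, P) \<in> set bs"
    and nz: "outcome_prob n (?e A) P (local_op n d k A *\<^sub>v v) y \<noteq> 0"
  proof (rule ccontr)
    assume "\<not> thesis"
    then have "outcome_prob n d (Measure k bs) v y = (\<Sum>_\<leftarrow>bs. 0)"
      unfolding outcome_prob.simps using that by (intro arg_cong[of _ _ sum_list] map_cong) auto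
    then show False using Measure.prems(4) by simp
  qed
  let ?L = "local_op n d k A"
  have "\<exists>x\<in>carrier_vec (\<Prod>j<n. ?e A j). fully_product n (?e A) x \<and> x \<bullet> (?L *\<^sub>v v) \<noteq> 0 \<and>
    (\<forall>w\<in>carrier_vec (\<Prod>j<n. ?e A j). outcome_prob n (?e A) P w y = 0 \<longrightarrow> x \<bullet> w = 0)"
    by (rule Measure.IH[OF AP _ loc(2)[OF AP] _ _ nz])
      (use dims[OF AP] op[OF AP] Measure.prems(2,3) in auto)
  then obtain x where x: "x \<in> carrier_vec (\<Prod>j<n. ?e A j)" "fully_product n (?e A) x"
      "x \<bullet> (?L *\<^sub>v v) \<noteq> 0"
    and x0: "\<And>w. w \<in> carrier_vec (\<Prod>j<n. ?e A j) \<Longrightarrow> outcome_prob n (?e A) P w y = 0 \<Longrightarrow> x \<bullet> w = 0"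
    by blast
  have adj: "(transpose_mat ?L *\<^sub>v x) \<bullet> w = x \<bullet> (?L *\<^sub>v w)" if "w \<in> carrier_vec (\<Prod>j<n. d j)" for w
    using transpose_vec_mult_scalar[OF op[OF AP] that x(1)] .
  \<comment> \<open>Inputs that never lead to \<open>y\<close> in the whole protocol never do so in
    the chosen branch, so the induction hypothesis applies to their images.\<close>
  have "outcome_prob n (?e A) P (?L *\<^sub>v w) y = 0" if "outcome_prob n d (Measure k bs) w y = 0" for w
  proof -
    let ?ps = "map (\<lambda>(A, P). outcome_prob n (?e A) P (local_op n d k A *\<^sub>v w) y) bs"
    have "\<forall>p\<in>set ?ps. p = 0"
      using that by (subst sum_list_nonneg_eq_0_iff[symmetric]) (auto simp: outcome_prob_nonneg)
    with AP show ?thesis by force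
  qed
  then show ?case
    using x op[OF AP] Measure.prems(3)
    by (intro bexI[of _ "transpose_mat ?L *\<^sub>v x"] conjI ballI impI
        fully_product_local_op_transpose Measure.prems(2) dims[OF AP])
      (auto simp: adj intro!: x0)
qed

section \<open>Expansion in an orthonormal basis\<close>

lemma complete_orthonormal_basis_carrier:
  assumes "complete_orthonormal_basis D \<psi>" "i < D"
  shows "\<psi> i \<in> carrier_vec D"
proof -
  interpret vec_space "TYPE(complex)" D .
  have "\<psi> ` {..<D} \<subseteq> carrier_vec D"
    using assms(1) unfolding complete_orthonormal_basis_def basis_def by simp
  with assms(2) show ?thesis by auto
qed

text \<open>Orthonormality says that the matrix with rows \<open>\<psi> i\<close> has its adjoint as
  a right inverse. For square matrices this is also a left inverse, and its entries give the
  resolution of the identity.\<close>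

lemma complete_orthonormal_basis_completeness:
  assumes "complete_orthonormal_basis D \<psi>" "r < D" "s < D"
  shows "(\<Sum>j<D. cnj (\<psi> j $ r) * \<psi> j $ s) = (if r = s then 1 else 0)"
proof -
  define U where "U = mat D D (\<lambda>(i, j). \<psi> i $ j)"
  define V where "V = mat D D (\<lambda>(i, j). cnj (\<psi> j $ i))"
  have "U * V = 1\<^sub>m D"
  proof (rule eq_matI)
    fix i j assume ij: "i < dim_row (1\<^sub>m D)" "j < dim_col (1\<^sub>m D)"
    then have "(U * V) $$ (i, j) = \<psi> i \<bullet>c \<psi> j"
      using complete_orthonormal_basis_carrier[OF assms(1), of i]
        complete_orthonormal_basis_carrier[OF assms(1), of j]
      by (auto simp: U_def V_def scalar_prod_def)
    then show "(U * V) $$ (i, j) = 1\<^sub>m D $$ (i, j)"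
      using ij assms(1) unfolding complete_orthonormal_basis_def by auto
  qed (auto simp: U_def V_def)
  then have "V * U = 1\<^sub>m D"
    by (rule mat_mult_left_right_inverse[rotated 2]) (auto simp: U_def V_def)
  then have "(V * U) $$ (r, s) = 1\<^sub>m D $$ (r, s)" by simp
  then show ?thesis
    using assms(2,3) by (auto simp: U_def V_def scalar_prod_def lessThan_atLeast0)
qed

text \<open>As \<open>x \<bullet> w\<close> is the inner product of \<open>w\<close> with
  \<open>conjugate x\<close>, the coefficient of \<open>conjugate x\<close> at
  \<open>\<psi> j\<close> is \<open>cnj (x \<bullet> \<psi> j)\<close>, and only the one at
  \<open>i\<close> survives.\<close>

lemma conjugate_eq_smult_basis_vec:
  assumes "complete_orthonormal_basis D \<psi>" "i < D" "x \<in> carrier_vec D"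
    and "\<And>j. j < D \<Longrightarrow> j \<noteq> i \<Longrightarrow> x \<bullet> \<psi> j = 0"
  shows "conjugate x = cnj (x \<bullet> \<psi> i) \<cdot>\<^sub>v \<psi> i"
proof (rule eq_vecI)
  note carr = complete_orthonormal_basis_carrier[OF assms(1)]
  show dim: "dim_vec (conjugate x) = dim_vec (cnj (x \<bullet> \<psi> i) \<cdot>\<^sub>v \<psi> i)"
    using assms(3) carr[OF assms(2)] by simp
  fix s assume "s < dim_vec (cnj (x \<bullet> \<psi> i) \<cdot>\<^sub>v \<psi> i)"
  then have s: "s < D" using dim assms(3) by simp
  have "conjugate x $ s = (\<Sum>r<D. cnj (x $ r) * (if r = s then 1 else 0))"
    using s assms(3) by (simp add: if_distrib[of "(*) _"] cong: if_cong)
  \<comment> \<open>The Kronecker delta is replaced by the resolution of the identity.\<close>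
  also have "\<dots> = (\<Sum>r<D. cnj (x $ r) * (\<Sum>j<D. cnj (\<psi> j $ r) * \<psi> j $ s))"
    using s by (intro sum.cong) (auto simp: complete_orthonormal_basis_completeness[OF assms(1)])
  also have "\<dots> = (\<Sum>j<D. \<Sum>r<D. cnj (x $ r) * (cnj (\<psi> j $ r) * \<psi> j $ s))"
    by (simp only: sum_distrib_left) (rule sum.swap)
  also have "\<dots> = (\<Sum>j<D. cnj (x \<bullet> \<psi> j) * \<psi> j $ s)"
    by (intro sum.cong) (auto simp: carrier_vecD[OF carr] scalar_prod_def sum_distrib_right mult.assoc lessThan_atLeast0)
  also have "\<dots> = (\<Sum>j<D. if j = i then cnj (x \<bullet> \<psi> i) * \<psi> i $ s else 0)"
    using assms(4) by (intro sum.cong) auto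
  finally show "conjugate x $ s = (cnj (x \<bullet> \<psi> i) \<cdot>\<^sub>v \<psi> i) $ s"
    using s assms(2) carr[OF assms(2)] by simp
qed

theorem theorem3:
  fixes n :: nat and d :: "nat \<Rightarrow> nat" and \<psi> :: "nat \<Rightarrow> complex vec"
  assumes "n \<ge> 2"
    and "\<forall>k<n. d k \<ge> 1"
    and "complete_orthonormal_basis (\<Prod>k<n. d k) \<psi>"
    and "\<forall>i<(\<Prod>k<n. d k). \<not> fully_product n d (\<psi> i)"
  shows "\<not> partial_LRA n d (\<Prod>k<n. d k) \<psi>"
proof
  let ?D = "\<Prod>k<n. d k"
  assume "partial_LRA n d ?D \<psi>"
  then obtain i and M :: "bool \<Rightarrow> complex mat" where i: "i < ?D"
    and M: "locc_implementable n d M" "(M True *\<^sub>v \<psi> i) \<bullet>c \<psi> i = 1"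
      "\<And>j. j < ?D \<Longrightarrow> j \<noteq> i \<Longrightarrow> (M True *\<^sub>v \<psi> j) \<bullet>c \<psi> j = 0"
    unfolding partial_LRA_def answerable_locc_def by blast
  then obtain P where P: "locc_protocol n d P"
    "\<And>v. v \<in> carrier_vec ?D \<Longrightarrow> v \<bullet>c v = 1 \<Longrightarrow>
      (M True *\<^sub>v v) \<bullet>c v = of_real (outcome_prob n d P v True)"
    unfolding locc_implementable_def by blast
  note carr = complete_orthonormal_basis_carrier[OF assms(3)]
  have d: "\<forall>k<n. d k > 0" using assms(2) by force
  \<comment> \<open>Basis vectors are unit vectors, so the conditions on the POVM become conditions
    on the protocol.\<close>
  have prob: "(M True *\<^sub>v \<psi> j) \<bullet>c \<psi> j = of_real (outcome_prob n d P (\<psi> j) True)" if "j < ?D" for j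
    using that carr assms(3) unfolding complete_orthonormal_basis_def by (intro P(2)) auto
  have "outcome_prob n d P (\<psi> i) True \<noteq> 0" using prob[OF i] M(2) by auto
  then obtain x where x: "x \<in> carrier_vec ?D" "fully_product n d x" "x \<bullet> \<psi> i \<noteq> 0"
    and x0: "\<And>w. w \<in> carrier_vec ?D \<Longrightarrow> outcome_prob n d P w True = 0 \<Longrightarrow> x \<bullet> w = 0"
    using ex_fully_product_functional[OF P(1) d carr[OF i]] by blast
  have "x \<bullet> \<psi> j = 0" if "j < ?D" "j \<noteq> i" for j
    using prob[OF that(1)] M(3)[OF that] by (intro x0 carr that) simp
  then have "conjugate x = cnj (x \<bullet> \<psi> i) \<cdot>\<^sub>v \<psi> i"
    by (intro conjugate_eq_smult_basis_vec[OF assms(3) i x(1)])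
  \<comment> \<open>The coefficient is nonzero because \<open>x\<close> does not vanish at
    \<open>\<psi> i\<close>, so the proportionality can be inverted.\<close>
  then have "\<psi> i = inverse (cnj (x \<bullet> \<psi> i)) \<cdot>\<^sub>v conjugate x"
    using x(3) by (simp add: smult_smult_assoc)
  moreover have "fully_product n d (inverse (cnj (x \<bullet> \<psi> i)) \<cdot>\<^sub>v conjugate x)"
    using assms(1) d x(2) by (intro fully_product_smult fully_product_conjugate) auto
  ultimately show False using assms(4) i by metis
qed

end
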